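(* Suppose $A(n) = \operatorname{ct}[P(\boldsymbol{x})^n Q(\boldsymbol{x})]$ for all $n \geq 0$, with Laurent polynomials $P, Q \in \mathbb{Q}[\boldsymbol{x}^{\pm 1}]$. Then the following are equivalent: (1) For all large enough primes $p$ and for all $r \geq 1$, $A(n)$ satisfies the Gauss congruences $A(p^r n) \equiv A(p^{r-1} n) \pmod{p^r}$ (for all integers $n \geq 0$). (2) For all large enough primes $p$, $A(n)$ satisfies the congruences $A(pn) \equiv A(n) \pmod{p}$ (for all integers $n \geq 0$). (3) $A(n) = A(0) \operatorname{ct}[P(\boldsymbol{x})^n]$ for all $n \geq 0$.
   Context: Here $\boldsymbol{x} = (x_1, \ldots, x_d)$, $\mathbb{Q}[\boldsymbol{x}^{\pm 1}] = \mathbb{Q}[x_1^{\pm 1}, \ldots, x_d^{\pm 1}]$, and $\operatorname{ct}[F]$ is the constant coefficient of a Laurent polynomial $F$. Congruences between rational numbers modulo $p^r$ are understood in the ring $\mathbb{Z}_p$ of $p$-adic integers (for large enough $p$ all $A(n)$ lie in $\mathbb{Z}_p$): $a \equiv b \pmod{p^r}$ means $a - b \in p^r \mathbb{Z}_p$. "For all large enough primes $p$" means that there is a bound $p_0$, independent of $n$ and $r$, such that the assertion holds for all primes $p \geq p_0$. *)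

theory Defs
  imports
    "HOL-Analysis.Finite_Cartesian_Product"
    "HOL-Library.Poly_Mapping"
    "HOL-Computational_Algebra.Primes"
begin

text \<open>
  Laurent polynomials over the rationals in variables indexed by the finite type \<open>'d\<close>:
  finitely supported functions from exponent vectors in \<open>\<int>\<^sup>d\<close> to coefficients, with the
  convolution product of \<^theory>\<open>HOL-Library.Poly_Mapping\<close>.
  (The synonym uses \<open>vec\<close> because the infix notation would force a sort constraint on \<open>'d\<close>.)
\<close>

type_synonym 'd laurent_poly = "(int, 'd) vec \<Rightarrow>\<^sub>0 rat"

definition ct :: "'d::finite laurent_poly \<Rightarrow> rat" where
  "ct F = Poly_Mapping.lookup F 0"

text \<open>
  The rational numbers lying in the ring of \<open>p\<close>-adic integers, for a prime \<open>p\<close>: the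
  denominator in lowest terms is not divisible by \<open>p\<close>. If the rational number \<open>a - b\<close> lies in
  \<open>p\<^sup>r\<close> times the \<open>p\<close>-adic integers, the cofactor \<open>(a - b) / p\<^sup>r\<close> is itself rational, so no
  other \<open>p\<close>-adic integers are needed for congruences between rational numbers.
\<close>

definition padic_integral_rats :: "nat \<Rightarrow> rat set" where
  "padic_integral_rats p = {x. \<not> int p dvd snd (quotient_of x)}"

text \<open>\<open>padic_cong p r a b\<close> is the congruence of \<open>a\<close> and \<open>b\<close> modulo \<open>p\<^sup>r\<close>.\<close>

definition padic_cong :: "nat \<Rightarrow> nat \<Rightarrow> rat \<Rightarrow> rat \<Rightarrow> bool" where
  "padic_cong p r a b \<longleftrightarrow> (\<exists>z\<in>padic_integral_rats p. a - b = of_nat p ^ r * z)"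

end

theory Submission
  imports Defs
begin

text \<open>
  Fix a prime \<open>p\<close> so large that all coefficients of \<open>P\<close> and \<open>Q\<close> are \<open>p\<close>-integral, and let
  \<open>\<Phi>\<close> be the Frobenius substitution \<open>x\<^sub>i \<mapsto> x\<^sub>i\<^sup>p\<close>. By the freshman's dream and Fermat's little
  theorem, \<open>F\<^sup>p \<equiv> \<Phi>(F)\<close> modulo \<open>p\<close> for every Laurent polynomial \<open>F\<close> with \<open>p\<close>-integral
  coefficients (\<open>power_prime_cong_frobenius_subst\<close>). Everything follows from this congruence,
  applied to \<open>F = P\<^sup>n\<close>.

  The Gauss congruences for \<open>ct(P\<^sup>n)\<close>, and hence for its multiples \<open>A(0) ct(P\<^sup>n)\<close>, hold because a
  congruence modulo a power of \<open>p\<close> gains one more factor \<open>p\<close> when both sides are raised to the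
  \<open>p\<close>-th power. So \<open>F\<close> raised to \<open>p\<^sup>r\<close> is congruent modulo \<open>p\<^sup>r\<close> to \<open>\<Phi>\<close> of \<open>F\<close> raised to
  \<open>p\<close> to the \<open>r - 1\<close> (\<open>cong_iterated_power\<close>), and \<open>\<Phi>\<close> is a ring homomorphism that
  preserves constant terms.

  Conversely, once \<open>p\<close> exceeds the absolute values of all exponents in \<open>Q\<close>, the product \<open>\<Phi>(F) Q\<close> has constant term
  \<open>ct(F) ct(Q)\<close>: the exponents of \<open>\<Phi>(F)\<close> are multiples of \<open>p\<close>, and only the constant
  monomial of \<open>Q\<close> can cancel such an exponent. So \<open>A(pn) \<equiv> A(0) ct(P\<^sup>n)\<close> modulo \<open>p\<close>. If also
  \<open>A(pn) \<equiv> A(n)\<close>, then the rational number \<open>A(n) - A(0) ct(P\<^sup>n)\<close>, which does not depend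
  on \<open>p\<close>, is divisible by all large primes and therefore zero
  (\<open>constant_term_factors_if_prime_congruences\<close>).
\<close>

section \<open>Congruences over a subring\<close>

text \<open>
  The cofactor is confined to \<open>S\<close>: over all of \<open>\<rat>\<close>, or over Laurent polynomials
  with rational coefficients, \<open>p\<close> is a unit and congruences modulo \<open>p\<close> would be trivial.
\<close>

definition cong_over :: "'a::comm_ring_1 set \<Rightarrow> 'a \<Rightarrow> 'a \<Rightarrow> 'a \<Rightarrow> bool" where
  "cong_over S m a b \<longleftrightarrow> (\<exists>s\<in>S. a - b = m * s)"

text \<open>
  The arguments of this section are needed twice: for the \<open>p\<close>-integral rational numbers
  and for the Laurent polynomials with such coefficients.
\<close>

locale unital_subring =
  fixes S :: "'a::comm_ring_1 set"
  assumes one_mem: "1 \<in> S"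
    and diff_mem: "a \<in> S \<Longrightarrow> b \<in> S \<Longrightarrow> a - b \<in> S"
    and mult_mem: "a \<in> S \<Longrightarrow> b \<in> S \<Longrightarrow> a * b \<in> S"
begin

lemma zero_mem: "0 \<in> S"
  using diff_mem[OF one_mem one_mem] by simp

lemma add_mem: "a \<in> S \<Longrightarrow> b \<in> S \<Longrightarrow> a + b \<in> S"
  using diff_mem[of a "0 - b"] diff_mem[OF zero_mem, of b] by simp

lemma power_mem: "a \<in> S \<Longrightarrow> a ^ n \<in> S"
  by (induction n) (auto intro: one_mem mult_mem)

lemma of_nat_mem: "of_nat n \<in> S"
  by (induction n) (auto intro: zero_mem one_mem add_mem)

lemma of_int_mem: "of_int i \<in> S"
  using diff_mem[OF zero_mem of_nat_mem] of_nat_mem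
  by (cases i rule: int_cases2) auto

lemma sum_mem: "(\<And>i. i \<in> I \<Longrightarrow> f i \<in> S) \<Longrightarrow> sum f I \<in> S"
  by (induction I rule: infinite_finite_induct) (auto intro: zero_mem add_mem)

lemma cong_refl: "cong_over S m a a"
  unfolding cong_over_def using zero_mem by force

lemma cong_sym: "cong_over S m a b \<Longrightarrow> cong_over S m b a"
  unfolding cong_over_def
proof safe
  fix s assume "s \<in> S" "a - b = m * s"
  then show "\<exists>s\<in>S. b - a = m * s"
    using diff_mem[OF zero_mem, of s] by (intro bexI[of _ "0 - s"]) (auto simp: algebra_simps)
qed

lemma cong_add:
  assumes "cong_over S m a b" "cong_over S m c d"
  shows "cong_over S m (a + c) (b + d)"
proof -
  obtain s t where "s \<in> S" "a - b = m * s" "t \<in> S" "c - d = m * t"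
    using assms unfolding cong_over_def by blast
  then show ?thesis
    unfolding cong_over_def by (intro bexI[of _ "s + t"]) (auto simp: algebra_simps add_mem)
qed

lemma cong_trans:
  "cong_over S m a b \<Longrightarrow> cong_over S m b c \<Longrightarrow> cong_over S m a c"
  using cong_add[of m a b b c] unfolding cong_over_def by simp

lemma cong_sum:
  "(\<And>i. i \<in> I \<Longrightarrow> cong_over S m (f i) (g i)) \<Longrightarrow> cong_over S m (sum f I) (sum g I)"
  by (induction I rule: infinite_finite_induct) (auto intro: cong_refl cong_add)

lemma cong_mult_right:
  assumes "cong_over S m a b" "c \<in> S"
  shows "cong_over S m (a * c) (b * c)"
proof -
  obtain s where "s \<in> S" "a - b = m * s"
    using assms unfolding cong_over_def by blast
  then show ?thesis
    unfolding cong_over_def using assms(2)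
    by (intro bexI[of _ "s * c"]) (auto simp: mult_mem mult.assoc simp flip: left_diff_distrib)
qed

lemma cong_mult:
  assumes "cong_over S m a b" "cong_over S m c d" "b \<in> S" "c \<in> S"
  shows "cong_over S m (a * c) (b * d)"
  using cong_trans[OF cong_mult_right[OF assms(1,4)]] cong_mult_right[OF assms(2,3)]
  by (simp add: mult.commute)

lemma cong_power:
  assumes "cong_over S m a b" "a \<in> S" "b \<in> S"
  shows "cong_over S m (a ^ n) (b ^ n)"
  by (induction n) (auto intro!: cong_refl cong_mult power_mem assms)

lemma cong_weaken:
  assumes "cong_over S (m * n) a b" "n \<in> S"
  shows "cong_over S m a b"
  using assms unfolding cong_over_def by (auto intro: mult_mem simp: mult.assoc)

lemma freshmans_dream:
  assumes "prime p" "a \<in> S" "b \<in> S"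
  shows "cong_over S (of_nat p) ((a + b) ^ p) (a ^ p + b ^ p)"
proof -
  let ?t = "\<lambda>k. of_nat (p choose k) * a ^ k * b ^ (p - k)"
  let ?u = "\<lambda>k. of_nat ((p choose k) div p) * a ^ k * b ^ (p - k)"
  have p: "p > 0"
    using assms(1) prime_gt_0_nat by blast
  have "(a + b) ^ p = (\<Sum>k\<le>p. ?t k)"
    by (rule binomial_ring)
  also have "{..p} = insert 0 (insert p {0<..<p})"
    using p by auto
  also have "sum ?t \<dots> = b ^ p + (a ^ p + (\<Sum>k\<in>{0<..<p}. ?t k))"
    using p by simp
  also have "(\<Sum>k\<in>{0<..<p}. ?t k) = (\<Sum>k\<in>{0<..<p}. of_nat p * ?u k)"
  proof (rule sum.cong)
    fix k assume "k \<in> {0<..<p}"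
    then have "p dvd (p choose k)"
      using assms(1) by (intro dvd_choose_prime) auto
    then have "(of_nat (p choose k) :: 'a) = of_nat p * of_nat ((p choose k) div p)"
      by (simp flip: of_nat_mult)
    then show "?t k = of_nat p * ?u k"
      by (simp add: mult.assoc)
  qed simp
  also have "\<dots> = of_nat p * (\<Sum>k\<in>{0<..<p}. ?u k)"
    by (simp add: sum_distrib_left)
  finally show ?thesis
    unfolding cong_over_def
    by (intro bexI[of _ "\<Sum>k\<in>{0<..<p}. ?u k"])
      (auto intro!: sum_mem mult_mem of_nat_mem power_mem assms)
qed

lemma freshmans_dream_sum:
  assumes "prime p" "\<And>i. i \<in> I \<Longrightarrow> f i \<in> S"
  shows "cong_over S (of_nat p) ((\<Sum>i\<in>I. f i) ^ p) (\<Sum>i\<in>I. f i ^ p)"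
  using assms(2)
proof (induction I rule: infinite_finite_induct)
  case (insert i I)
  have "f i \<in> S" "sum f I \<in> S"
    using insert.prems by (auto intro: sum_mem)
  then have "cong_over S (of_nat p) ((f i + sum f I) ^ p) (f i ^ p + sum f I ^ p)"
    by (rule freshmans_dream[OF assms(1)])
  moreover have "cong_over S (of_nat p) (f i ^ p + sum f I ^ p) (f i ^ p + (\<Sum>i\<in>I. f i ^ p))"
    using insert by (intro cong_add cong_refl) auto
  ultimately show ?case
    using insert.hyps cong_trans by simp
qed (use assms(1) prime_gt_0_nat[of p] in \<open>simp_all add: cong_refl zero_power\<close>)

text \<open>
  In \<open>a\<^sup>p - b\<^sup>p = (a - b) (\<Sum>i<p. b\<^sup>p\<^sup>-\<^sup>1\<^sup>-\<^sup>i a\<^sup>i)\<close> the second factor has \<open>p\<close> terms, all congruent to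
  the same power of \<open>b\<close> modulo \<open>p\<close>, so it contributes the additional factor \<open>p\<close>.
\<close>

lemma cong_power_lift:
  assumes "cong_over S (of_nat p ^ Suc s) a b" "a \<in> S" "b \<in> S"
  shows "cong_over S (of_nat p ^ Suc (Suc s)) (a ^ p) (b ^ p)"
proof (cases "p = 0")
  case False
  let ?c = "\<Sum>i<p. b ^ (p - Suc i) * a ^ i"
  have "cong_over S (of_nat p) a b"
    using assms(1) by (auto intro!: cong_weaken[of "of_nat p" "of_nat p ^ s"] power_mem of_nat_mem)
  then have "cong_over S (of_nat p) ?c (\<Sum>i<p. b ^ (p - Suc i) * b ^ i)"
    by (intro cong_sum cong_mult cong_refl cong_power power_mem assms)
  also have "(\<Sum>i<p. b ^ (p - Suc i) * b ^ i) = of_nat p * b ^ (p - 1)"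
    by (simp flip: power_add)
  finally obtain t where t: "t \<in> S" "?c - of_nat p * b ^ (p - 1) = of_nat p * t"
    unfolding cong_over_def by blast
  obtain u where u: "u \<in> S" "a - b = of_nat p ^ Suc s * u"
    using assms(1) unfolding cong_over_def by blast
  have c: "?c = of_nat p * (b ^ (p - 1) + t)"
    using t(2) by (simp add: algebra_simps)
  have "a ^ p - b ^ p = (of_nat p ^ Suc s * u) * (of_nat p * (b ^ (p - 1) + t))"
    unfolding power_diff_sumr2 u(2) c ..
  also have "\<dots> = of_nat p ^ Suc (Suc s) * (u * (b ^ (p - 1) + t))"
    by (simp add: ac_simps)
  finally show ?thesis
    unfolding cong_over_def using t(1) u(1) assms(3)
    by (auto intro!: mult_mem add_mem power_mem)
qed (simp add: cong_refl)

lemma cong_iterated_power: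
  assumes "cong_over S (of_nat p) (a ^ p) b" "a \<in> S" "b \<in> S"
  shows "cong_over S (of_nat p ^ Suc s) (a ^ (p ^ Suc s)) (b ^ (p ^ s))"
proof (induction s)
  case (Suc s)
  have "cong_over S (of_nat p ^ Suc (Suc s)) ((a ^ p ^ Suc s) ^ p) ((b ^ p ^ s) ^ p)"
    by (intro cong_power_lift Suc power_mem assms)
  then show ?case
    by (simp add: mult.commute flip: power_mult)
qed (use assms in simp)

text \<open>
  The freshman's dream carries the congruence from \<open>i\<close> to \<open>i + 1\<close> and also back, so
  induction in both directions reaches all integers.
\<close>

lemma fermat_of_int:
  assumes "prime p"
  shows "cong_over S (of_nat p) (of_int i ^ p) (of_int i)"
proof (induction i rule: int_induct[where k = 0])
  case base
  show ?case using assms prime_gt_0_nat[of p] by (simp add: cong_refl zero_power)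
next
  case (step1 i)
  have "cong_over S (of_nat p) ((of_int i + 1) ^ p) (of_int i ^ p + 1 ^ p)"
    by (intro freshmans_dream assms of_int_mem one_mem)
  from cong_trans[OF this cong_add[OF step1(2) cong_refl]] show ?case
    by simp
next
  case (step2 i)
  have "cong_over S (of_nat p) ((of_int (i - 1) + 1) ^ p) (of_int (i - 1) ^ p + 1 ^ p)"
    by (intro freshmans_dream assms of_int_mem one_mem)
  from cong_trans[OF cong_sym[OF this]] step2(2)
  have "cong_over S (of_nat p) (of_int (i - 1) ^ p + 1) (of_int i)"
    by simp
  from cong_add[OF this cong_refl[of _ "-1"]] show ?case
    by simp
qed

end

section \<open>Rational numbers integral at a prime\<close>

text \<open>
  Any fraction for \<open>x\<close> can witness integrality, because the denominator in lowest terms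
  divides all others. Closure under arithmetic is evident in this form.
\<close>

lemma padic_integral_rats_iff:
  assumes "prime p"
  shows "x \<in> padic_integral_rats p \<longleftrightarrow>
    (\<exists>a b. x = of_int a / of_int b \<and> \<not> int p dvd b)"
proof
  assume "x \<in> padic_integral_rats p"
  then show "\<exists>a b. x = of_int a / of_int b \<and> \<not> int p dvd b"
    unfolding padic_integral_rats_def using quotient_of_div[of x "fst (quotient_of x)"]
    by (metis (no_types) mem_Collect_eq prod.collapse)
next
  assume "\<exists>a b. x = of_int a / of_int b \<and> \<not> int p dvd b"
  then obtain a b where ab: "x = of_int a / of_int b" "\<not> int p dvd b"
    by blast
  obtain c d where cd: "quotient_of x = (c, d)"
    by fastforce
  have "d > 0" "coprime c d" "x = of_int c / of_int d"
    using cd quotient_of_denom_pos quotient_of_coprime quotient_of_div by blast+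
  moreover have "b \<noteq> 0"
    using ab by auto
  ultimately have "(of_int (a * d) :: rat) = of_int (c * b)"
    using ab by (simp add: field_simps)
  then have "d dvd c * b"
    unfolding of_int_eq_iff by (metis dvd_triv_right)
  then have "d dvd b"
    using \<open>coprime c d\<close> by (simp add: coprime_commute coprime_dvd_mult_right_iff)
  then show "x \<in> padic_integral_rats p"
    using ab(2) cd unfolding padic_integral_rats_def by (auto dest: dvd_trans)
qed

lemma unital_subring_padic_integral_rats:
  assumes "prime p"
  shows "unital_subring (padic_integral_rats p)"
proof
  show "1 \<in> padic_integral_rats p"
    using prime_gt_1_nat[OF assms] by (auto simp: padic_integral_rats_def)
next
  fix x y assume "x \<in> padic_integral_rats p" "y \<in> padic_integral_rats p"
  then obtain a b c d where
    x: "x = of_int a / of_int b" "\<not> int p dvd b" and y: "y = of_int c / of_int d" "\<not> int p dvd d"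
    unfolding padic_integral_rats_iff[OF assms] by blast
  have bd: "\<not> int p dvd b * d" "b \<noteq> 0" "d \<noteq> 0"
    using x y assms by (auto simp: prime_dvd_mult_iff)
  have "x - y = of_int (a * d - c * b) / of_int (b * d)"
    using bd by (simp add: x y field_simps)
  then show "x - y \<in> padic_integral_rats p"
    using bd unfolding padic_integral_rats_iff[OF assms] by blast
  have "x * y = of_int (a * c) / of_int (b * d)"
    by (simp add: x y)
  then show "x * y \<in> padic_integral_rats p"
    using bd unfolding padic_integral_rats_iff[OF assms] by blast
qed

lemma padic_cong_iff_cong_over:
  "padic_cong p r = cong_over (padic_integral_rats p) (of_nat p ^ r)"
  by (simp add: fun_eq_iff padic_cong_def cong_over_def)

text \<open>
  If \<open>x = a / b\<close>, then Fermat's theorem for the integers \<open>a\<close> and \<open>b\<close> gives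
  \<open>b\<^sup>p x\<^sup>p = a\<^sup>p \<equiv> a = b x \<equiv> b\<^sup>p x\<close>, and \<open>b\<^sup>p\<close> is a unit among the \<open>p\<close>-integral numbers.
\<close>

lemma fermat_padic_integral_rats:
  assumes "prime p" "x \<in> padic_integral_rats p"
  shows "cong_over (padic_integral_rats p) (of_nat p) (x ^ p) x"
proof -
  interpret R: unital_subring "padic_integral_rats p"
    by (rule unital_subring_padic_integral_rats) fact
  obtain a b where ab: "x = of_int a / of_int b" "\<not> int p dvd b"
    using assms padic_integral_rats_iff by blast
  have "b \<noteq> 0"
    using ab by auto
  have inv: "1 / of_int b ^ p \<in> padic_integral_rats p"
    unfolding padic_integral_rats_iff[OF assms(1)]
    by (rule exI[of _ 1], rule exI[of _ "b ^ p"])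
      (use ab(2) assms(1) in \<open>auto simp: prime_dvd_power_iff prime_gt_0_nat\<close>)
  have "cong_over (padic_integral_rats p) (of_nat p) (of_int a ^ p) (of_int a)"
    by (rule R.fermat_of_int) fact
  moreover have "cong_over (padic_integral_rats p) (of_nat p) (of_int b * x) (of_int b ^ p * x)"
    by (intro R.cong_mult_right R.cong_sym[OF R.fermat_of_int] assms)
  moreover have "of_int a = of_int b * x"
    using ab \<open>b \<noteq> 0\<close> by simp
  ultimately have "cong_over (padic_integral_rats p) (of_nat p) (of_int a ^ p) (of_int b ^ p * x)"
    using R.cong_trans by metis
  from R.cong_mult_right[OF this inv] show ?thesis
    using \<open>b \<noteq> 0\<close> by (simp add: ab(1) power_divide)
qed

lemma eventually_padic_integral: "\<forall>\<^sub>F p in at_top. x \<in> padic_integral_rats p"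
  using eventually_gt_at_top[of "nat (snd (quotient_of x))"]
proof eventually_elim
  case (elim p)
  then show ?case
    using quotient_of_denom_pos'[of x] by (auto simp: padic_integral_rats_def dest: zdvd_imp_le)
qed

text \<open>A prime that divides \<open>x\<close> divides its nonzero numerator, which bounds it.\<close>

lemma eventually_not_cong_zero:
  assumes "x \<noteq> 0"
  shows "\<forall>\<^sub>F p in at_top. prime p \<longrightarrow> \<not> padic_cong p 1 x 0"
proof -
  obtain u v where uv: "quotient_of x = (u, v)"
    by fastforce
  have v: "v > 0" and x: "x = of_int u / of_int v"
    using uv quotient_of_denom_pos quotient_of_div by blast+
  show ?thesis
    using eventually_gt_at_top[of "nat \<bar>u\<bar>"]
  proof eventually_elim
    case (elim p)
    show ?case
    proof safe
      assume p: "prime p" and "padic_cong p 1 x 0"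
      then obtain a b where ab: "x = of_nat p * (of_int a / of_int b)" "\<not> int p dvd b"
        unfolding padic_cong_def using padic_integral_rats_iff[OF p] by auto
      moreover have "b \<noteq> 0"
        using ab by auto
      ultimately have "(of_int (u * b) :: rat) = of_int (int p * (a * v))"
        using v by (simp add: x field_simps)
      then have "int p dvd u * b"
        unfolding of_int_eq_iff by simp
      then have "int p dvd u"
        using ab(2) p by (simp add: prime_dvd_mult_iff)
      moreover have "u \<noteq> 0"
        using assms x by auto
      ultimately show False
        using elim dvd_imp_le_int[of u "int p"] by auto
    qed
  qed
qed

section \<open>The Frobenius substitution on Laurent polynomials\<close>

definition coeffs_in :: "'b set \<Rightarrow> ('k \<Rightarrow>\<^sub>0 'b::zero) set" where
  "coeffs_in S = {F. \<forall>k. Poly_Mapping.lookup F k \<in> S}"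

lemma unital_subring_coeffs_in:
  fixes S :: "'b::comm_ring_1 set"
  assumes "unital_subring S"
  shows "unital_subring (coeffs_in S :: ('k::comm_monoid_add \<Rightarrow>\<^sub>0 'b) set)"
proof -
  interpret unital_subring S by fact
  have sum_any: "Sum_any f \<in> S" if "\<And>i. f i \<in> S" for f :: "'k \<Rightarrow> 'b"
    using that unfolding Sum_any.expand_set by (intro sum_mem)
  show ?thesis
    by standard
      (auto simp: coeffs_in_def lookup_one lookup_minus lookup_mult when_def
        intro!: one_mem zero_mem diff_mem sum_any mult_mem)
qed

lemma eventually_coeffs_padic_integral:
  "\<forall>\<^sub>F p in at_top. prime p \<longrightarrow> F \<in> coeffs_in (padic_integral_rats p)"
proof -
  have "\<forall>\<^sub>F p in at_top. \<forall>k\<in>Poly_Mapping.keys F.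
      Poly_Mapping.lookup F k \<in> padic_integral_rats p"
    by (intro eventually_ball_finite ballI eventually_padic_integral) simp
  then show ?thesis
  proof eventually_elim
    case (elim p)
    show ?case
    proof
      assume "prime p"
      then interpret unital_subring "padic_integral_rats p"
        by (rule unital_subring_padic_integral_rats)
      show "F \<in> coeffs_in (padic_integral_rats p)"
        using elim zero_mem by (force simp: coeffs_in_def in_keys_iff)
    qed
  qed
qed

lemma sum_single_lookup:
  assumes "finite K" "Poly_Mapping.keys F \<subseteq> K"
  shows "(\<Sum>k\<in>K. Poly_Mapping.single k (Poly_Mapping.lookup F k)) = F"
proof (rule poly_mapping_eqI)
  fix k
  show "Poly_Mapping.lookup (\<Sum>k\<in>K. Poly_Mapping.single k (Poly_Mapping.lookup F k)) k =
    Poly_Mapping.lookup F k"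
    using assms by (auto simp: lookup_sum lookup_single when_def sum.delta in_keys_iff)
qed

lemma single_power:
  "Poly_Mapping.single k c ^ n =
    Poly_Mapping.single (of_nat n * (k :: 'k::comm_semiring_1)) ((c :: 'b::comm_semiring_1) ^ n)"
  by (induction n) (simp_all add: mult_single algebra_simps)

lemma of_nat_mult_single:
  "of_nat m * Poly_Mapping.single (k :: 'k::comm_monoid_add) (c :: 'b::comm_semiring_1) =
    Poly_Mapping.single k (of_nat m * c)"
  using mult_single[of 0 "of_nat m" k c] by simp

lemma lookup_of_nat_mult:
  fixes F :: "'k::comm_monoid_add \<Rightarrow>\<^sub>0 'b::comm_semiring_1"
  shows "Poly_Mapping.lookup (of_nat m * F) k = of_nat m * Poly_Mapping.lookup F k"
  by (induction m) (simp_all add: lookup_add algebra_simps)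

lemma cong_over_lookup:
  fixes F :: "'k::comm_monoid_add \<Rightarrow>\<^sub>0 'b::comm_ring_1"
  assumes "cong_over (coeffs_in S) (of_nat m) F G"
  shows "cong_over S (of_nat m) (Poly_Mapping.lookup F k) (Poly_Mapping.lookup G k)"
proof -
  obtain H where "H \<in> coeffs_in S" "F - G = of_nat m * H"
    using assms unfolding cong_over_def by blast
  then show ?thesis
    unfolding cong_over_def coeffs_in_def by (metis lookup_minus lookup_of_nat_mult mem_Collect_eq)
qed

text \<open>
  The substitution \<open>x\<^sub>i \<mapsto> x\<^sub>i\<^sup>p\<close>. Exponent vectors form a ring under componentwise
  multiplication, in which multiplication by \<open>of_nat p\<close> is dilation by \<open>p\<close>.
\<close>

definition frobenius_subst :: "nat \<Rightarrow> ('k::comm_semiring_1 \<Rightarrow>\<^sub>0 'b) \<Rightarrow> ('k \<Rightarrow>\<^sub>0 'b::comm_semiring_1)" where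
  "frobenius_subst p F =
    (\<Sum>k\<in>Poly_Mapping.keys F. Poly_Mapping.single (of_nat p * k) (Poly_Mapping.lookup F k))"

lemma frobenius_subst_superset:
  assumes "finite K" "Poly_Mapping.keys F \<subseteq> K"
  shows "frobenius_subst p F =
    (\<Sum>k\<in>K. Poly_Mapping.single (of_nat p * k) (Poly_Mapping.lookup F k))"
  unfolding frobenius_subst_def
  by (rule sum.mono_neutral_left) (use assms in \<open>auto simp: in_keys_iff\<close>)

lemma frobenius_subst_single [simp]:
  "frobenius_subst p (Poly_Mapping.single k c) = Poly_Mapping.single (of_nat p * k) c"
  by (subst frobenius_subst_superset[of "{k}"]) auto

lemma frobenius_subst_add:
  "frobenius_subst p (F + G) = frobenius_subst p F + frobenius_subst p G"
proof -
  let ?K = "Poly_Mapping.keys F \<union> Poly_Mapping.keys G"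
  have "frobenius_subst p H =
      (\<Sum>k\<in>?K. Poly_Mapping.single (of_nat p * k) (Poly_Mapping.lookup H k))"
    if "H = F + G \<or> H = F \<or> H = G" for H
    using that keys_add[of F G] by (intro frobenius_subst_superset) auto
  then show ?thesis
    by (simp add: lookup_add single_add sum.distrib)
qed

lemma frobenius_subst_sum:
  "frobenius_subst p (\<Sum>i\<in>I. f i) = (\<Sum>i\<in>I. frobenius_subst p (f i))"
  by (induction I rule: infinite_finite_induct)
    (simp_all add: frobenius_subst_add, simp_all add: frobenius_subst_def)

lemma frobenius_subst_mult:
  "frobenius_subst p (F * G) = frobenius_subst p F * frobenius_subst p G"
proof -
  let ?f = "\<lambda>k. Poly_Mapping.single k (Poly_Mapping.lookup F k)"
  let ?g = "\<lambda>k. Poly_Mapping.single k (Poly_Mapping.lookup G k)"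
  have "frobenius_subst p ((\<Sum>k\<in>Poly_Mapping.keys F. ?f k) * (\<Sum>k\<in>Poly_Mapping.keys G. ?g k)) =
    frobenius_subst p F * frobenius_subst p G"
    by (simp add: sum_product frobenius_subst_sum mult_single distrib_left)
      (simp add: frobenius_subst_def sum_product mult_single)
  then show ?thesis
    by (simp add: sum_single_lookup)
qed

lemma frobenius_subst_power:
  "frobenius_subst p (F ^ n) = frobenius_subst p F ^ n"
proof (induction n)
  case 0
  show ?case
    using frobenius_subst_single[of p 0 1] by simp
qed (simp add: frobenius_subst_mult)

lemma frobenius_subst_coeffs_in:
  assumes "unital_subring S" "F \<in> coeffs_in S"
  shows "frobenius_subst p F \<in> coeffs_in S"
proof -
  interpret L: unital_subring "coeffs_in S"
    by (rule unital_subring_coeffs_in) fact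
  interpret unital_subring S by fact
  show ?thesis
    unfolding frobenius_subst_def using assms(2)
    by (intro L.sum_mem) (auto simp: coeffs_in_def lookup_single when_def zero_mem)
qed

text \<open>
  Write \<open>F\<close> as a sum of monomials. Modulo \<open>p\<close> the \<open>p\<close>-th power may be taken term by term;
  it dilates each exponent and, by Fermat, leaves each coefficient unchanged.
\<close>

lemma power_prime_cong_frobenius_subst:
  fixes F :: "'k::comm_semiring_1 \<Rightarrow>\<^sub>0 rat"
  assumes "prime p" "F \<in> coeffs_in (padic_integral_rats p)"
  shows "cong_over (coeffs_in (padic_integral_rats p)) (of_nat p) (F ^ p) (frobenius_subst p F)"
proof -
  let ?R = "padic_integral_rats p"
  let ?F = "\<lambda>k. Poly_Mapping.single k (Poly_Mapping.lookup F k)"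
  interpret R: unital_subring ?R
    by (rule unital_subring_padic_integral_rats) fact
  interpret L: unital_subring "coeffs_in ?R :: ('k \<Rightarrow>\<^sub>0 rat) set"
    by (intro unital_subring_coeffs_in unital_subring_padic_integral_rats) fact
  have mono: "Poly_Mapping.single k c \<in> coeffs_in ?R" if "c \<in> ?R" for k :: 'k and c
    using that R.zero_mem by (auto simp: coeffs_in_def lookup_single when_def)
  have "cong_over (coeffs_in ?R) (of_nat p) ((\<Sum>k\<in>Poly_Mapping.keys F. ?F k) ^ p)
      (\<Sum>k\<in>Poly_Mapping.keys F. ?F k ^ p)"
    by (intro L.freshmans_dream_sum assms mono) (use assms in \<open>auto simp: coeffs_in_def\<close>)
  moreover have "cong_over (coeffs_in ?R) (of_nat p) (\<Sum>k\<in>Poly_Mapping.keys F. ?F k ^ p)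
      (frobenius_subst p F)"
    unfolding frobenius_subst_def
  proof (rule L.cong_sum)
    fix k
    obtain s where "s \<in> ?R" "Poly_Mapping.lookup F k ^ p - Poly_Mapping.lookup F k = of_nat p * s"
      using fermat_padic_integral_rats[OF assms(1), of "Poly_Mapping.lookup F k"] assms(2)
      unfolding cong_over_def coeffs_in_def by blast
    then show "cong_over (coeffs_in ?R) (of_nat p) (?F k ^ p)
        (Poly_Mapping.single (of_nat p * k) (Poly_Mapping.lookup F k))"
      unfolding cong_over_def
      by (intro bexI[of _ "Poly_Mapping.single (of_nat p * k) s"] mono)
        (simp_all add: single_power of_nat_mult_single flip: single_diff)
  qed
  ultimately show ?thesis
    using L.cong_trans by (simp add: sum_single_lookup)
qed

section \<open>Constant terms\<close>

lemma ct_single_mult: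
  "ct (Poly_Mapping.single k c * F) = c * Poly_Mapping.lookup F (- k)"
proof -
  have "(0 = k + q) = (q = - k)" for q
    by (metis add.commute add_eq_0_iff)
  then show ?thesis
    by (simp add: ct_def lookup_mult lookup_single when_mult)
qed

lemma ct_sum: "ct (\<Sum>i\<in>I. f i) = (\<Sum>i\<in>I. ct (f i))"
  by (simp add: ct_def lookup_sum)

text \<open>
  The monomial of \<open>F\<close> with exponent \<open>k\<close> contributes through the coefficient of \<open>Q\<close> at
  \<open>- p k\<close>, which vanishes unless \<open>k = 0\<close>.
\<close>

lemma ct_frobenius_subst_mult:
  fixes F Q :: "'d::finite laurent_poly"
  assumes "\<And>l. of_nat p * l \<in> Poly_Mapping.keys Q \<Longrightarrow> l = 0"
  shows "ct (frobenius_subst p F * Q) = ct F * ct Q"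
proof -
  have "ct (frobenius_subst p F * Q) =
      (\<Sum>k\<in>Poly_Mapping.keys F. Poly_Mapping.lookup F k * Poly_Mapping.lookup Q (of_nat p * (- k)))"
    by (simp add: frobenius_subst_def sum_distrib_right ct_sum ct_single_mult)
  also have "\<dots> = (\<Sum>k\<in>Poly_Mapping.keys F. if k = 0 then ct F * ct Q else 0)"
    by (rule sum.cong) (use assms[of "- k" for k] in \<open>auto simp: ct_def in_keys_iff\<close>)
  also have "\<dots> = ct F * ct Q"
    by (auto simp: ct_def in_keys_iff)
  finally show ?thesis .
qed

lemma of_nat_mult_vec_eq_0:
  fixes l :: "(int, 'd::finite) vec"
  assumes "p > 0" "of_nat p * l = 0"
  shows "l = 0"
  using assms by (simp add: vec_eq_iff of_nat_index)

lemma ct_frobenius_subst: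
  fixes F :: "'d::finite laurent_poly"
  assumes "p > 0"
  shows "ct (frobenius_subst p F) = ct F"
proof -
  have "ct (frobenius_subst p F * 1) = ct F * ct (1 :: 'd laurent_poly)"
    by (rule ct_frobenius_subst_mult) (use of_nat_mult_vec_eq_0[OF assms] in auto)
  then show ?thesis
    by (simp add: ct_def)
qed

text \<open>A nonzero vector in \<open>p \<int>\<^sup>d\<close> has a coordinate of absolute value at least \<open>p\<close>.\<close>

lemma eventually_no_dilated_exponent:
  fixes Q :: "'d::finite laurent_poly"
  shows "\<forall>\<^sub>F p::nat in at_top. \<forall>l. of_nat p * l \<in> Poly_Mapping.keys Q \<longrightarrow> l = 0"
proof -
  have "\<forall>\<^sub>F p::nat in at_top. \<forall>k\<in>Poly_Mapping.keys Q. \<forall>i. \<bar>k $ i\<bar> < int p"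
  proof (intro eventually_ball_finite eventually_all_finite ballI)
    fix k :: "(int, 'd) vec" and i
    show "\<forall>\<^sub>F p::nat in at_top. \<bar>k $ i\<bar> < int p"
      using eventually_gt_at_top[of "nat \<bar>k $ i\<bar>"] by eventually_elim linarith
  qed simp
  then show ?thesis
  proof eventually_elim
    case (elim p)
    have "l $ i = 0" if "of_nat p * l \<in> Poly_Mapping.keys Q" for l i
    proof (rule ccontr)
      assume "l $ i \<noteq> 0"
      then have "int p * 1 \<le> int p * \<bar>l $ i\<bar>"
        by (intro mult_left_mono) auto
      moreover have "\<bar>(of_nat p * l) $ i\<bar> < int p"
        using elim that by blast
      ultimately show False
        by (simp add: of_nat_index abs_mult)
    qed
    then show ?case
      by (simp add: vec_eq_iff)
  qed
qed

lemma ct_gauss_congruence: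
  fixes F :: "'d::finite laurent_poly"
  assumes "prime p" "F \<in> coeffs_in (padic_integral_rats p)"
  shows "padic_cong p (Suc s) (ct (F ^ (p ^ Suc s))) (ct (F ^ (p ^ s)))"
proof -
  let ?R = "padic_integral_rats p"
  interpret L: unital_subring "coeffs_in ?R :: 'd laurent_poly set"
    by (intro unital_subring_coeffs_in unital_subring_padic_integral_rats) fact
  have "cong_over (coeffs_in ?R) (of_nat p ^ Suc s) (F ^ (p ^ Suc s)) (frobenius_subst p F ^ (p ^ s))"
    by (intro L.cong_iterated_power power_prime_cong_frobenius_subst assms
        frobenius_subst_coeffs_in unital_subring_padic_integral_rats)
  then have "cong_over ?R (of_nat (p ^ Suc s)) (ct (F ^ (p ^ Suc s)))
      (ct (frobenius_subst p (F ^ (p ^ s))))"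
    unfolding ct_def frobenius_subst_power by (intro cong_over_lookup) simp
  then show ?thesis
    using prime_gt_0_nat[OF assms(1)]
    by (simp add: ct_frobenius_subst padic_cong_iff_cong_over)
qed

lemma ct_power_prime_mult_cong:
  fixes F Q :: "'d::finite laurent_poly"
  assumes "prime p" "F \<in> coeffs_in (padic_integral_rats p)" "Q \<in> coeffs_in (padic_integral_rats p)"
    and "\<And>l. of_nat p * l \<in> Poly_Mapping.keys Q \<Longrightarrow> l = 0"
  shows "padic_cong p 1 (ct (F ^ p * Q)) (ct F * ct Q)"
proof -
  let ?R = "padic_integral_rats p"
  interpret L: unital_subring "coeffs_in ?R :: 'd laurent_poly set"
    by (intro unital_subring_coeffs_in unital_subring_padic_integral_rats) fact
  have "cong_over (coeffs_in ?R) (of_nat p) (F ^ p * Q) (frobenius_subst p F * Q)"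
    by (intro L.cong_mult_right power_prime_cong_frobenius_subst assms)
  then have "cong_over ?R (of_nat p) (ct (F ^ p * Q)) (ct (frobenius_subst p F * Q))"
    unfolding ct_def by (rule cong_over_lookup)
  then show ?thesis
    using ct_frobenius_subst_mult[OF assms(4)]
    by (simp add: padic_cong_iff_cong_over)
qed

section \<open>The three equivalent conditions\<close>

lemma eq_if_eventually_padic_cong:
  assumes "\<forall>\<^sub>F p in at_top. prime p \<longrightarrow> padic_cong p 1 a b"
  shows "a = b"
proof (rule ccontr)
  assume "a \<noteq> b"
  then have "\<forall>\<^sub>F p in at_top. prime p \<longrightarrow> \<not> padic_cong p 1 (a - b) 0"
    by (intro eventually_not_cong_zero) simp
  with assms have "\<forall>\<^sub>F p::nat in at_top. \<not> prime p"
    by eventually_elim (auto simp: padic_cong_def)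
  then obtain N where "\<And>p::nat. p \<ge> N \<Longrightarrow> \<not> prime p"
    by (auto simp: eventually_at_top_linorder)
  then show False
    using bigger_prime[of N] by (auto dest: less_imp_le)
qed

text \<open>The scalar \<open>c\<close> takes the place of \<open>A(0)\<close>, which may have a denominator of its own.\<close>

lemma eventually_gauss_congruences:
  fixes P :: "'d::finite laurent_poly"
  shows "\<forall>\<^sub>F p in at_top. prime p \<longrightarrow> (\<forall>r\<ge>1. \<forall>n.
    padic_cong p r (c * ct (P ^ (p ^ r * n))) (c * ct (P ^ (p ^ (r - 1) * n))))"
  using eventually_coeffs_padic_integral[of P] eventually_padic_integral[of c]
proof eventually_elim
  case (elim p)
  show ?case
  proof (intro impI allI)
    fix r n :: nat assume p: "prime p" and "r \<ge> 1"
    then obtain s where r: "r = Suc s"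
      by (cases r) auto
    interpret R: unital_subring "padic_integral_rats p"
      by (rule unital_subring_padic_integral_rats) fact
    interpret L: unital_subring "coeffs_in (padic_integral_rats p) :: 'd laurent_poly set"
      by (intro unital_subring_coeffs_in unital_subring_padic_integral_rats) fact
    have "padic_cong p (Suc s) (ct ((P ^ n) ^ (p ^ Suc s))) (ct ((P ^ n) ^ (p ^ s)))"
      using elim p by (intro ct_gauss_congruence L.power_mem) auto
    then show "padic_cong p r (c * ct (P ^ (p ^ r * n))) (c * ct (P ^ (p ^ (r - 1) * n)))"
      using R.cong_mult_right[OF _ elim(2)]
      by (simp add: r padic_cong_iff_cong_over mult.commute[of c] mult.commute[of _ n] power_mult)
  qed
qed

text \<open>
  For large \<open>p\<close>, both \<open>ct(P\<^sup>n Q)\<close> and \<open>ct(Q) ct(P\<^sup>n)\<close> are congruent to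
  \<open>ct(P\<^sup>p\<^sup>n Q)\<close> modulo \<open>p\<close>, and neither of them depends on \<open>p\<close>.
\<close>

lemma constant_term_factors_if_prime_congruences:
  fixes P Q :: "'d::finite laurent_poly"
  assumes "\<forall>\<^sub>F p in at_top. prime p \<longrightarrow> (\<forall>n. padic_cong p 1 (ct (P ^ (p * n) * Q)) (ct (P ^ n * Q)))"
  shows "ct (P ^ n * Q) = ct Q * ct (P ^ n)"
proof (rule eq_if_eventually_padic_cong)
  show "\<forall>\<^sub>F p in at_top. prime p \<longrightarrow> padic_cong p 1 (ct (P ^ n * Q)) (ct Q * ct (P ^ n))"
    using assms eventually_coeffs_padic_integral[of P] eventually_coeffs_padic_integral[of Q]
      eventually_no_dilated_exponent[of Q]
  proof eventually_elim
    case (elim p)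
    show ?case
    proof
      assume p: "prime p"
      interpret R: unital_subring "padic_integral_rats p"
        by (rule unital_subring_padic_integral_rats) fact
      interpret L: unital_subring "coeffs_in (padic_integral_rats p) :: 'd laurent_poly set"
        by (intro unital_subring_coeffs_in unital_subring_padic_integral_rats) fact
      (* P^(p n) is read as the p-th power of P^n, so that the dilated factor is P^n. *)
      have "padic_cong p 1 (ct ((P ^ n) ^ p * Q)) (ct (P ^ n) * ct Q)"
        using elim p by (intro ct_power_prime_mult_cong L.power_mem) auto
      moreover have "padic_cong p 1 (ct (P ^ (p * n) * Q)) (ct (P ^ n * Q))"
        using elim p by blast
      ultimately show "padic_cong p 1 (ct (P ^ n * Q)) (ct Q * ct (P ^ n))"
        unfolding padic_cong_iff_cong_over
        by (metis R.cong_sym R.cong_trans mult.commute power_mult)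
    qed
  qed
qed

theorem proposition5p1:
  fixes P Q :: "'d::finite laurent_poly" and A :: "nat \<Rightarrow> rat"
  assumes "\<And>n. A n = ct (P ^ n * Q)"
  shows "((\<exists>p0::nat. \<forall>p\<ge>p0. prime p \<longrightarrow>
            (\<forall>r\<ge>1. \<forall>n. padic_cong p r (A (p ^ r * n)) (A (p ^ (r - 1) * n))))
          \<longleftrightarrow> (\<exists>p0::nat. \<forall>p\<ge>p0. prime p \<longrightarrow> (\<forall>n. padic_cong p 1 (A (p * n)) (A n))))
       \<and> ((\<exists>p0::nat. \<forall>p\<ge>p0. prime p \<longrightarrow> (\<forall>n. padic_cong p 1 (A (p * n)) (A n)))
          \<longleftrightarrow> (\<forall>n. A n = A 0 * ct (P ^ n)))"
    (is "(?gauss \<longleftrightarrow> ?prime) \<and> (?prime \<longleftrightarrow> ?factors)")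
proof -
  have "?prime" if gauss: ?gauss
  proof -
    obtain p0 where p0: "\<And>p r n. p \<ge> p0 \<Longrightarrow> prime p \<Longrightarrow> r \<ge> 1 \<Longrightarrow>
        padic_cong p r (A (p ^ r * n)) (A (p ^ (r - 1) * n))"
      using gauss by blast
    show ?thesis
      using p0[where r = 1] by auto
  qed
  moreover have "?factors" if ?prime
    using constant_term_factors_if_prime_congruences[of P Q] that
    unfolding eventually_at_top_linorder assms by simp
  moreover have "?gauss" if factors: ?factors
  proof -
    have "?gauss \<longleftrightarrow> (\<forall>\<^sub>F p in at_top. prime p \<longrightarrow> (\<forall>r\<ge>1. \<forall>n. padic_cong p r
        (A 0 * ct (P ^ (p ^ r * n))) (A 0 * ct (P ^ (p ^ (r - 1) * n)))))"
      unfolding eventually_at_top_linorder using factors by metis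
    then show ?thesis
      using eventually_gauss_congruences by blast
  qed
  ultimately show ?thesis
    by blast
qed

end
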